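(* Let $K = [-1,1]$ and let $f(x) = x^{2k}$ for an integer $k \geq 1$. Then $$f^{(r)}_{\mathrm{pfm}} = \Omega\left(\frac{1}{r^2}\right) \quad \text{as } r \to \infty,$$ i.e., there is a constant $c > 0$ (independent of $r$) such that $f^{(r)}_{\mathrm{pfm}} \geq c/r^2$ for all sufficiently large $r \in \mathbb{N}$.
   Context: Let $\Sigma[t]_r$ denote the set of univariate real polynomials of degree at most $2r$ that can be written as a sum of squares of real polynomials, and let $\lambda$ be the Lebesgue measure on $K=[-1,1]$. For $r \in \mathbb{N}$ define $$f^{(r)}_{\mathrm{pfm}} := \min\left\{ \int_K f(x)\, s(f(x))\, d\lambda(x) \;:\; s \in \Sigma[t]_r,\ \int_K s(f(x))\, d\lambda(x) = 1 \right\}.$$ Equivalently, $f^{(r)}_{\mathrm{pfm}} = \min\{ \int_{f(K)} t\, s(t)\, d\lambda_f(t) : s \in \Sigma[t]_r,\ \int_{f(K)} s(t)\, d\lambda_f(t) = 1\}$, where $\lambda_f$ is the push-forward measure $\lambda_f(B) = \lambda(f^{-1}(B))$ for Borel sets $B \subseteq \mathbb{R}$. Note that here $\min_{x\in K} f(x) = 0$. *)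

theory Defs
  imports "HOL-Analysis.Analysis" "HOL-Computational_Algebra.Polynomial"
begin

definition sos_poly :: "nat \<Rightarrow> real poly set" where
  "sos_poly r = {s. degree s \<le> 2 * r \<and> (\<exists>ps. s = (\<Sum>p\<leftarrow>ps. p\<^sup>2))}"

definition pfm_values :: "real set \<Rightarrow> (real \<Rightarrow> real) \<Rightarrow> nat \<Rightarrow> real set" where
  "pfm_values K f r =
     {(LINT x|lebesgue_on K. f x * poly s (f x)) | s.
        s \<in> sos_poly r \<and> (LINT x|lebesgue_on K. poly s (f x)) = 1}"

text \<open>
  The minimum is rendered by the infimum; the lemmas below show that the set of values is nonempty
  and bounded below for the functions of interest, so that \<^const>\<open>Inf\<close> is a genuine infimum,
  and that it agrees with the minimum whenever the latter is attained.
\<close>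

definition pfm :: "real set \<Rightarrow> (real \<Rightarrow> real) \<Rightarrow> nat \<Rightarrow> real" where
  "pfm K f r = Inf (pfm_values K f r)"

lemma sos_poly_nonneg:
  assumes "s \<in> sos_poly r"
  shows "poly s t \<ge> 0"
proof -
  have "poly (\<Sum>p\<leftarrow>ps. p\<^sup>2) t \<ge> 0" for ps :: "real poly list"
    by (induction ps) auto
  with assms show ?thesis
    by (auto simp: sos_poly_def)
qed

lemma pfm_values_nonempty:
  assumes "K \<in> lmeasurable" "measure lebesgue K > 0"
  shows "pfm_values K f r \<noteq> {}"
proof -
  define a where "a = 1 / measure lebesgue K"
  have "[:a:] = (\<Sum>p\<leftarrow>[[:sqrt a:]]. p\<^sup>2)"
    using assms(2) by (simp add: a_def power2_eq_square)
  then have "[:a:] \<in> sos_poly r"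
    unfolding sos_poly_def by (smt (verit) degree_pCons_0 mem_Collect_eq zero_le)
  moreover have "(LINT x|lebesgue_on K. poly [:a:] (f x)) = 1"
    using assms by (simp add: a_def measure_restrict_space space_restrict_space fmeasurableD)
  ultimately show ?thesis
    unfolding pfm_values_def by blast
qed

lemma pfm_values_bdd_below:
  assumes "\<And>x. x \<in> K \<Longrightarrow> f x \<ge> 0"
  shows "bdd_below (pfm_values K f r)"
  by (rule bdd_belowI[of _ 0])
     (auto simp: pfm_values_def space_restrict_space
           intro!: integral_nonneg_AE AE_I2 mult_nonneg_nonneg assms sos_poly_nonneg)

lemma pfm_eq_minimum:
  assumes "m \<in> pfm_values K f r" "\<And>v. v \<in> pfm_values K f r \<Longrightarrow> m \<le> v"
  shows "pfm K f r = m"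
  unfolding pfm_def by (rule cInf_eq_minimum) (use assms in auto)

end

theory Submission
  imports Defs
begin

text \<open>
  With \<open>a = 1 / (2 k)\<close>, the functional \<open>L p = \<integral> p (x^(2k)) dx\<close> integrates against a multiple of the
  Jacobi weight \<open>t^(a - 1)\<close> on \<open>[0, 1]\<close>. The Jacobi operator is symmetric and triangular with
  eigenvalues \<open>n (n + a)\<close>, which gives the Bernstein inequality
  \<open>L (t (1 - t) p'^2) \<le> n (n + a) L (p^2)\<close> for \<open>degree p \<le> n\<close>. On the other hand, integration by parts
  gives \<open>a L ((1 - t) p^2) = - 2 L (t (1 - t) p p') + L (t p^2)\<close>, so a small value of \<open>L (t p^2)\<close>
  forces a large derivative (an uncertainty principle). Together these yield
  \<open>L (t p^2) \<ge> c / r^2 * L (p^2)\<close> for \<open>degree p \<le> r\<close>.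
\<close>

section \<open>Positive functionals with the integration-by-parts rule of a Jacobi weight\<close>

lemmas poly_identity_simps =
  poly_eq_poly_eq_iff[symmetric] fun_eq_iff
  pderiv_add pderiv_mult pderiv_smult pderiv_minus pderiv_pCons

lemma quadratic_nonneg_imp_linear_zero:
  fixes u v :: real
  assumes "\<And>s. u + s * v \<ge> 0"
  shows "v = 0"
proof (rule ccontr)
  assume "v \<noteq> 0"
  with assms[of "- (u + 1) / v"] show False by simp
qed

text \<open>Models integration over \<open>[0, 1]\<close> against a multiple of
  \<open>t^(a - 1)\<close>. In \<open>by_parts\<close> the boundary term at 0 vanishes because
  \<open>a > 0\<close>, the one at 1 because \<open>q\<close> vanishes there.\<close>

locale jacobi_functional =
  fixes L :: "real poly \<Rightarrow> real" and a :: real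
  assumes add: "L (p + q) = L p + L q"
    and smult: "L (smult c p) = c * L p"
    and nonneg: "(\<And>t. 0 \<le> t \<Longrightarrow> t \<le> 1 \<Longrightarrow> poly p t \<ge> 0) \<Longrightarrow> L p \<ge> 0"
    and by_parts: "poly q 1 = 0 \<Longrightarrow> L ([:0, 1:] * pderiv q) = - a * L q"
    and a_pos: "a > 0"
begin

lemma minus: "L (- p) = - L p"
  using smult[of "-1" p] by simp

lemma diff: "L (p - q) = L p - L q"
  using add[of p "- q"] minus[of q] by simp

lemma zero: "L 0 = 0"
  using smult[of 0 0] by simp

lemma square_nonneg: "L (p * p) \<ge> 0"
  by (rule nonneg) simp

section \<open>Orthogonality, the Jacobi operator and the Bernstein inequality\<close>

lemma null_square_orthogonal:
  assumes "L (p * p) = 0"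
  shows "L (f * p) = 0"
proof -
  have "L (f * f) + s * (2 * L (f * p)) \<ge> 0" for s
  proof -
    have "(f + smult s p) * (f + smult s p)
        = f * f + smult (2 * s) (f * p) + smult (s * s) (p * p)"
      by (simp add: poly_identity_simps algebra_simps)
    then have "L ((f + smult s p) * (f + smult s p))
        = L (f * f) + 2 * s * L (f * p) + s * s * L (p * p)"
      by (simp add: add smult)
    with square_nonneg[of "f + smult s p"] assms show ?thesis
      by (simp add: algebra_simps)
  qed
  then have "2 * L (f * p) = 0" by (rule quadratic_nonneg_imp_linear_zero)
  then show ?thesis by simp
qed

text \<open>Gram-Schmidt on the monomials. Vanishing of all coefficients from \<open>n\<close> on
  encodes "degree below \<open>n\<close>"; at \<open>n = 0\<close> it leaves only the zero
  polynomial, so the base case is trivial.\<close>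

lemma orthogonal_projection:
  "\<exists>q. (\<forall>i\<ge>n. coeff q i = 0) \<and> (\<forall>g. (\<forall>i\<ge>n. coeff g i = 0) \<longrightarrow> L ((f - q) * g) = 0)"
proof (induction n arbitrary: f)
  case 0
  show ?case
    by (rule exI[of _ 0]) (auto simp: zero poly_eq_iff[of _ 0, simplified, symmetric])
next
  case (Suc n)
  obtain m where m: "\<forall>i\<ge>n. coeff m i = 0"
      "\<And>g. \<forall>i\<ge>n. coeff g i = 0 \<Longrightarrow> L ((monom 1 n - m) * g) = 0"
    using Suc.IH by blast
  obtain q where q: "\<forall>i\<ge>n. coeff q i = 0"
      "\<And>g. \<forall>i\<ge>n. coeff g i = 0 \<Longrightarrow> L ((f - q) * g) = 0"
    using Suc.IH by blast
  define P where "P = monom 1 n - m"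
  define c where "c = L ((f - q) * P) / L (P * P)"
  \<comment> \<open>If \<open>L (P * P) = 0\<close>, division by zero gives \<open>c = 0\<close>,
    and the left side is 0 as well by the degenerate case of Cauchy-Schwarz.\<close>
  have c: "L ((f - q) * P) = c * L (P * P)"
    using null_square_orthogonal[of P "f - q"] by (auto simp: c_def)
  have "L ((f - (q + smult c P)) * g) = 0" if g: "\<forall>i\<ge>Suc n. coeff g i = 0" for g
  proof -
    define b where "b = coeff g n"
    \<comment> \<open>Removing the leading term of \<open>g\<close> leaves \<open>h\<close> of
      degree below \<open>n\<close>, to which both \<open>f - q\<close> and \<open>P\<close> are
      orthogonal.\<close>
    define h where "h = g - smult b P"
    have h: "\<forall>i\<ge>n. coeff h i = 0"
    proof (intro allI impI)
      fix i
      assume "i \<ge> n"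
      with g m(1) show "coeff h i = 0"
        by (cases "i = n") (simp_all add: h_def P_def b_def)
    qed
    have "(f - (q + smult c P)) * g
        = smult b ((f - q) * P) + (f - q) * h - smult (b * c) (P * P) - smult c (P * h)"
      by (simp add: h_def algebra_simps smult_add_right smult_diff_right)
    then show ?thesis
      using m(2)[OF h] q(2)[OF h] by (simp add: add smult diff c flip: P_def)
  qed
  moreover have "\<forall>i\<ge>Suc n. coeff (q + smult c P) i = 0"
    using q(1) m(1) by (auto simp: P_def)
  ultimately show ?case by blast
qed

text \<open>The Sturm-Liouville operator \<open>- t^(1 - a) (t^a (1 - t) p')'\<close>, expanded so
  that it stays within polynomials.\<close>

definition jacobi_op :: "real poly \<Rightarrow> real poly" where
  "jacobi_op p = [:- a, 1 + a:] * pderiv p - [:0, 1, -1:] * pderiv (pderiv p)"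

text \<open>In the monomial basis the operator is upper bidiagonal: it preserves degree bounds, and
  its eigenvalues stand on the diagonal.\<close>

lemma coeff_jacobi_op:
  "coeff (jacobi_op p) i
     = real i * (real i + a) * coeff p i - (real i + 1) * (real i + a) * coeff p (Suc i)"
proof (cases i)
  case 0
  then show ?thesis by (simp add: jacobi_op_def coeff_pderiv)
next
  case (Suc j)
  then show ?thesis
    by (cases j) (simp_all add: jacobi_op_def coeff_pderiv algebra_simps)
qed

text \<open>Integration by parts for \<open>(1 - t) p' q\<close>, where \<open>1 - t\<close> kills
  the boundary value at 1. Since the left side is symmetric in \<open>p\<close> and
  \<open>q\<close>, the operator is symmetric for \<open>L\<close>.\<close>

lemma energy_eq_jacobi_op:
  "L ([:0, 1, -1:] * (pderiv p * pderiv q)) = L (jacobi_op p * q)"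
proof -
  define u where "u = pderiv p * q"
  have "L ([:0, 1:] * pderiv ([:1, -1:] * u)) = - a * L ([:1, -1:] * u)"
    by (rule by_parts) simp
  moreover have "[:0, 1, -1:] * (pderiv p * pderiv q) - jacobi_op p * q
      = [:0, 1:] * pderiv ([:1, -1:] * u) + smult a ([:1, -1:] * u)"
    by (simp add: poly_identity_simps jacobi_op_def u_def algebra_simps)
  then have "L ([:0, 1, -1:] * (pderiv p * pderiv q) - jacobi_op p * q)
      = L ([:0, 1:] * pderiv ([:1, -1:] * u)) + a * L ([:1, -1:] * u)"
    by (simp only: add smult)
  ultimately show ?thesis
    by (simp only: diff)
qed

text \<open>Split off the component of \<open>p\<close> along the monic orthogonal polynomial
  \<open>P\<close> of top degree. The splitting is orthogonal both for \<open>L\<close> and for the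
  energy, and the eigenvalues increase with \<open>n\<close>.\<close>

lemma bernstein:
  assumes "\<forall>i>n. coeff p i = 0"
  shows "L ([:0, 1, -1:] * (pderiv p * pderiv p)) \<le> real n * (real n + a) * L (p * p)"
  using assms
proof (induction n arbitrary: p)
  case 0
  then have "degree p = 0" by (metis degree_0 leading_coeff_0_iff neq0_conv)
  then show ?case by (simp add: pderiv_eq_0_iff[THEN iffD2] zero)
next
  case (Suc n)
  let ?ev = "\<lambda>n. real n * (real n + a)"
  let ?N = "Suc n"
  let ?E = "\<lambda>p q. L ([:0, 1, -1:] * (pderiv p * pderiv q))"
  obtain m where m: "\<forall>i\<ge>?N. coeff m i = 0"
      "\<And>g. \<forall>i\<ge>?N. coeff g i = 0 \<Longrightarrow> L ((monom 1 ?N - m) * g) = 0"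
    using orthogonal_projection by blast
  define P where "P = monom 1 ?N - m"
  have orth: "L (P * g) = 0" if "\<forall>i\<ge>?N. coeff g i = 0" for g
    using m(2)[OF that] by (simp add: P_def)
  have P: "coeff P ?N = 1" "\<forall>i>?N. coeff P i = 0"
    using m(1) by (auto simp: P_def)
  define c where "c = coeff p ?N"
  define q where "q = p - smult c P"
  have p: "p = smult c P + q" by (simp add: q_def)
  have q: "\<forall>i\<ge>?N. coeff q i = 0"
    using Suc.prems P by (auto simp: q_def c_def le_less)
  \<comment> \<open>The operator does not raise the degree of \<open>q\<close>, so by symmetry the
    cross energy of \<open>P\<close> and \<open>q\<close> vanishes.\<close>
  have "\<forall>i\<ge>?N. coeff (jacobi_op q) i = 0"
    using q by (simp add: coeff_jacobi_op)
  from orth[OF this] have Eq: "?E P q = 0"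
    using energy_eq_jacobi_op[of q P] by (simp add: mult.commute)
  \<comment> \<open>The leading coefficients cancel, so \<open>P\<close> is an eigenvector up to a
    remainder orthogonal to \<open>P\<close>, which suffices for its energy.\<close>
  define h where "h = jacobi_op P - smult (?ev ?N) P"
  have "\<forall>i\<ge>?N. coeff h i = 0"
    using P by (auto simp: h_def coeff_jacobi_op le_less)
  from orth[OF this] have "L (P * h) = 0" .
  moreover have "jacobi_op P * P = smult (?ev ?N) (P * P) + P * h"
    by (simp add: h_def algebra_simps)
  ultimately have EP: "?E P P = ?ev ?N * L (P * P)"
    by (simp only: energy_eq_jacobi_op add smult)
  have "[:0, 1, -1:] * (pderiv p * pderiv p)
      = smult (c * c) ([:0, 1, -1:] * (pderiv P * pderiv P))
        + smult (2 * c) ([:0, 1, -1:] * (pderiv P * pderiv q))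
        + [:0, 1, -1:] * (pderiv q * pderiv q)"
    by (simp add: poly_identity_simps p algebra_simps)
  then have "?E p p = c * c * (?ev ?N * L (P * P)) + ?E q q"
    by (simp only: add smult EP Eq mult_zero_right add_0_right)
  also have "?E q q \<le> ?ev n * L (q * q)"
    using q by (intro Suc.IH) auto
  also have "?ev n * L (q * q) \<le> ?ev ?N * L (q * q)"
    using a_pos by (intro mult_right_mono mult_mono square_nonneg) auto
  also have "c * c * (?ev ?N * L (P * P)) + ?ev ?N * L (q * q) = ?ev ?N * L (p * p)"
  proof -
    have "p * p = smult (c * c) (P * P) + smult (2 * c) (P * q) + q * q"
      by (simp add: poly_identity_simps p algebra_simps)
    then have "L (p * p) = c * c * L (P * P) + L (q * q)"
      by (simp only: add smult orth[OF q] mult_zero_right add_0_right)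
    then show ?thesis by (simp only: distrib_left mult_ac)
  qed
  finally show ?case by simp
qed

section \<open>Uncertainty inequality and the lower bound for the first moment\<close>

lemma uncertainty:
  assumes "M > 0"
  shows "a * L ([:1, -1:] * (p * p))
    \<le> L ([:0, 1, -1:] * (pderiv p * pderiv p)) / M + (M + 1) * L ([:0, 1:] * (p * p))"
proof -
  let ?b = "[:0, 1, -1:] :: real poly"
  have "L ([:0, 1:] * pderiv ([:1, -1:] * (p * p))) = - a * L ([:1, -1:] * (p * p))"
    by (rule by_parts) simp
  moreover have "[:0, 1:] * pderiv ([:1, -1:] * (p * p))
      = smult 2 (?b * (p * pderiv p)) - [:0, 1:] * (p * p)"
    by (simp add: poly_identity_simps algebra_simps)
  ultimately have eq: "a * L ([:1, -1:] * (p * p))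
      = - 2 * L (?b * (p * pderiv p)) + L ([:0, 1:] * (p * p))"
    by (simp only: add smult diff)
  \<comment> \<open>Expanding this square bounds the cross term \<open>p p'\<close> by AM-GM, with
    \<open>M\<close> left free for later optimisation.\<close>
  have "poly (?b * ((pderiv p + smult M p) * (pderiv p + smult M p))) t \<ge> 0"
    if "0 \<le> t" "t \<le> 1" for t
  proof -
    have "poly ?b t = t * (1 - t)" by (simp add: algebra_simps)
    with that have "poly ?b t \<ge> 0" by simp
    then show ?thesis by (simp only: poly_mult zero_le_mult_iff) auto
  qed
  from nonneg[OF this]
  have "0 \<le> L (?b * ((pderiv p + smult M p) * (pderiv p + smult M p)))" .
  also have "?b * ((pderiv p + smult M p) * (pderiv p + smult M p))
      = ?b * (pderiv p * pderiv p) + smult (2 * M) (?b * (p * pderiv p))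
        + smult (M * M) (?b * (p * p))"
    by (simp add: poly_identity_simps algebra_simps)
  finally have "0 \<le> L (?b * (pderiv p * pderiv p)) + 2 * M * L (?b * (p * pderiv p))
      + M * M * L (?b * (p * p))"
    by (simp only: add smult)
  then have "- 2 * L (?b * (p * pderiv p))
      \<le> L (?b * (pderiv p * pderiv p)) / M + M * L (?b * (p * p))"
    using assms by (simp add: field_simps del: mult_pCons_left)
  moreover have "L (?b * (p * p)) \<le> L ([:0, 1:] * (p * p))"
  proof -
    have "L ([:0, 1:] * (p * p) - ?b * (p * p)) \<ge> 0"
      by (rule nonneg) (simp add: algebra_simps flip: power2_eq_square)
    then show ?thesis by (simp only: diff)
  qed
  then have "M * L (?b * (p * p)) \<le> M * L ([:0, 1:] * (p * p))"
    using assms by (intro mult_left_mono) auto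
  ultimately show ?thesis
    unfolding eq by (simp only: distrib_right mult_1)
qed

lemma first_moment_lower_bound:
  assumes "a \<le> 1" "r \<ge> 1" "degree p \<le> r"
  shows "a\<^sup>2 / 12 / (real r)\<^sup>2 * L (p * p) \<le> L ([:0, 1:] * (p * p))"
proof -
  define A where "A = L (p * p)"
  define B where "B = L ([:0, 1:] * (p * p))"
  define R where "R = (real r)\<^sup>2"
  have R: "R \<ge> 1" using assms(2) by (simp add: R_def)
  have A: "A \<ge> 0" unfolding A_def by (rule square_nonneg)
  have B: "B \<ge> 0" unfolding B_def by (rule nonneg) simp
  have "L ([:1, -1:] * (p * p)) = A - B"
  proof -
    have "[:1, -1:] * (p * p) = p * p - [:0, 1:] * (p * p)" by simp
    then show ?thesis by (simp only: diff A_def B_def)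
  qed
  \<comment> \<open>With \<open>M = 4 * R / a\<close> the Bernstein bound \<open>2 * R * A\<close>
    turns the energy term into \<open>a / 2 * A\<close>, half of \<open>a * A\<close>. The other
    half is at most \<open>6 * R / a * B\<close>, whence the constant 12.\<close>
  then have "a * (A - B) \<le> L ([:0, 1, -1:] * (pderiv p * pderiv p)) / (4 * R / a) + (4 * R / a + 1) * B"
    using uncertainty[of "4 * R / a" p] a_pos R by (simp only: B_def) simp
  also have "L ([:0, 1, -1:] * (pderiv p * pderiv p)) \<le> 2 * R * A"
  proof -
    have "real r * (real r + a) \<le> 2 * R"
    proof -
      have "real r * (real r + a) \<le> real r * (2 * real r)"
        using assms by (intro mult_left_mono) auto
      then show ?thesis by (simp add: R_def power2_eq_square)
    qed
    then have "real r * (real r + a) * A \<le> 2 * R * A"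
      using A by (rule mult_right_mono)
    moreover have "\<forall>i>r. coeff p i = 0"
      using assms(3) by (simp add: coeff_eq_0)
    ultimately show ?thesis
      unfolding A_def using bernstein[of r p] by (blast intro: order_trans)
  qed
  then have "L ([:0, 1, -1:] * (pderiv p * pderiv p)) / (4 * R / a) \<le> a / 2 * A"
    using a_pos R by (simp add: field_simps del: mult_pCons_left)
  finally have "a / 2 * A \<le> (4 * R / a + 1 + a) * B"
    by (simp only: right_diff_distrib distrib_right) linarith
  also have "\<dots> \<le> (6 * R / a) * B"
  proof (rule mult_right_mono[OF _ B])
    have "a + a * a \<le> 2 * R"
      using assms(1) a_pos R mult_mono[of a 1 a 1] by simp
    then have "1 + a \<le> 2 * R / a"
      using a_pos by (simp add: pos_le_divide_eq algebra_simps)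
    then show "4 * R / a + 1 + a \<le> 6 * R / a" by simp
  qed
  finally have "a\<^sup>2 / 12 / R * A \<le> B"
    using a_pos R by (simp add: field_simps power2_eq_square)
  then show ?thesis by (simp only: A_def B_def R_def)
qed

end

section \<open>Degrees of the summands in a sum of squares\<close>

lemma coeff_square_top:
  fixes p :: "'a :: comm_semiring_1 poly"
  assumes "degree p \<le> m"
  shows "coeff (p\<^sup>2) (2 * m) = (coeff p m)\<^sup>2"
proof -
  have "coeff (p * p) (2 * m) = (\<Sum>i\<le>2 * m. coeff p i * coeff p (2 * m - i))"
    by (rule coeff_mult)
  also have "\<dots> = (\<Sum>i\<in>{m}. coeff p i * coeff p (2 * m - i))"
  proof (rule sum.mono_neutral_right)
    show "\<forall>i\<in>{..2 * m} - {m}. coeff p i * coeff p (2 * m - i) = 0"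
    proof
      fix i
      assume "i \<in> {..2 * m} - {m}"
      then have "i > m \<or> 2 * m - i > m" by auto
      then show "coeff p i * coeff p (2 * m - i) = 0"
        using assms by (auto simp: coeff_eq_0)
    qed
  qed auto
  finally show ?thesis by (simp add: power2_eq_square mult_2)
qed

text \<open>At twice the largest degree \<open>m\<close>, the coefficient of the sum is a sum of
  real squares, at least one of them positive, so no cancellation can occur.\<close>

lemma degree_sos_summand_le:
  fixes ps :: "real poly list"
  assumes "degree (\<Sum>p\<leftarrow>ps. p\<^sup>2) \<le> 2 * r" "p \<in> set ps"
  shows "degree p \<le> r"
proof -
  define m where "m = Max (degree ` set ps)"
  have m: "degree q \<le> m" if "q \<in> set ps" for q
    using that by (simp add: m_def)
  have "m \<in> degree ` set ps"
    unfolding m_def using assms(2) by (intro Max_in) auto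
  then obtain q where q: "q \<in> set ps" "degree q = m" by auto
  have "m \<le> r"
  proof (rule ccontr)
    assume "\<not> m \<le> r"
    then have "q \<noteq> 0" using q(2) by auto
    have "coeff (\<Sum>p\<leftarrow>ps. p\<^sup>2) (2 * m) = (\<Sum>p\<leftarrow>ps. (coeff p m)\<^sup>2)"
      using m by (induction ps) (auto simp: coeff_square_top)
    moreover have "coeff (\<Sum>p\<leftarrow>ps. p\<^sup>2) (2 * m) = 0"
      using assms(1) \<open>\<not> m \<le> r\<close> by (intro coeff_eq_0) simp
    ultimately have "(\<Sum>p\<leftarrow>ps. (coeff p m)\<^sup>2) = 0" by simp
    moreover have "(coeff q m)\<^sup>2 \<le> (\<Sum>p\<leftarrow>ps. (coeff p m)\<^sup>2)"
      using q(1) by (intro member_le_sum_list) auto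
    ultimately have "coeff q m = 0" by simp
    with q(2) \<open>q \<noteq> 0\<close> show False by auto
  qed
  with m[OF assms(2)] show ?thesis by simp
qed

section \<open>The functional of \<open>x^(2k)\<close> and the final bound\<close>

definition even_power_integral :: "nat \<Rightarrow> real poly \<Rightarrow> real" where
  "even_power_integral k p = integral {-1..1} (\<lambda>x. poly p (x ^ (2 * k)))"

lemma even_power_integrable:
  "(\<lambda>x::real. poly p (x ^ (2 * k))) integrable_on {-1..1}"
  by (intro integrable_continuous_real continuous_intros)

text \<open>The integrand is the derivative of \<open>x p(x^(2k))\<close>; the exponent being even,
  each end point contributes \<open>p(1)\<close>.\<close>

lemma even_power_integral_by_parts:
  "even_power_integral k p + 2 * real k * even_power_integral k ([:0, 1:] * pderiv p) = 2 * poly p 1"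
proof -
  have "((\<lambda>x. poly p (x ^ (2 * k)) + 2 * real k * poly ([:0, 1:] * pderiv p) (x ^ (2 * k)))
      has_integral (1 * poly p (1 ^ (2 * k)) - (-1) * poly p ((-1) ^ (2 * k)))) {-1..1}"
  proof (rule fundamental_theorem_of_calculus)
    fix x :: real
    have "((\<lambda>x. x * poly p (x ^ (2 * k))) has_real_derivative
        poly p (x ^ (2 * k)) + 2 * real k * poly ([:0, 1:] * pderiv p) (x ^ (2 * k))) (at x)"
    proof -
      have "k > 0 \<Longrightarrow> x ^ (2 * k - Suc 0) * x = x ^ (2 * k)"
        by (cases k) auto
      then show ?thesis
        by (auto intro!: derivative_eq_intros DERIV_chain2[OF poly_DERIV])
    qed
    then show "((\<lambda>x. x * poly p (x ^ (2 * k))) has_vector_derivative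
        poly p (x ^ (2 * k)) + 2 * real k * poly ([:0, 1:] * pderiv p) (x ^ (2 * k)))
        (at x within {-1..1})"
      by (simp only: has_real_derivative_iff_has_vector_derivative has_vector_derivative_at_within)
  qed simp
  moreover have "((\<lambda>x. poly p (x ^ (2 * k)) + 2 * real k * poly ([:0, 1:] * pderiv p) (x ^ (2 * k)))
      has_integral (even_power_integral k p
        + 2 * real k * even_power_integral k ([:0, 1:] * pderiv p))) {-1..1}"
    unfolding even_power_integral_def
    by (intro has_integral_add has_integral_mult_right integrable_integral even_power_integrable)
  ultimately show ?thesis
    by (simp add: has_integral_unique del: mult_pCons_left)
qed

text \<open>Integration by parts in \<open>x\<close> replaces the substitution
  \<open>t = x^(2k)\<close>, so the singular weight \<open>t^(a - 1)\<close> never appears.\<close>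

lemma jacobi_functional_even_power:
  assumes "k \<ge> 1"
  shows "jacobi_functional (even_power_integral k) (1 / (2 * real k))"
proof
  show "even_power_integral k (p + q) = even_power_integral k p + even_power_integral k q" for p q
    by (simp add: even_power_integral_def integral_add even_power_integrable)
  show "even_power_integral k (smult c p) = c * even_power_integral k p" for c p
    by (simp add: even_power_integral_def)
  show "even_power_integral k p \<ge> 0"
    if "\<And>t. 0 \<le> t \<Longrightarrow> t \<le> 1 \<Longrightarrow> poly p t \<ge> 0" for p
    unfolding even_power_integral_def
  proof (rule integral_nonneg[OF even_power_integrable])
    fix x :: real
    assume "x \<in> {-1..1}"
    then have "\<bar>x\<bar> ^ (2 * k) \<le> 1" by (intro power_le_one) auto
    then show "0 \<le> poly p (x ^ (2 * k))" by (intro that) (auto simp: power_even_abs)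
  qed
  show "even_power_integral k ([:0, 1:] * pderiv q) = - (1 / (2 * real k)) * even_power_integral k q"
    if "poly q 1 = 0" for q
    using even_power_integral_by_parts[of k q] that assms by (simp add: field_simps del: mult_pCons_left)
  show "1 / (2 * real k) > 0" using assms by simp
qed

text \<open>Links the Lebesgue integral in \<open>pfm\<close> to the gauge integral, for which the
  fundamental theorem of calculus was applied.\<close>

lemma lebesgue_integral_eq_even_power_integral:
  "(LINT x|lebesgue_on {-1..1}. poly p (x ^ (2 * k))) = even_power_integral k p"
  unfolding even_power_integral_def
  by (intro lebesgue_integral_eq_integral continuous_imp_integrable_real continuous_intros) auto

theorem theorem3:
  fixes k :: nat
  assumes "k \<ge> 1"
  shows "\<exists>c>0. \<forall>\<^sub>F r in sequentially. pfm {-1..1} (\<lambda>x. x ^ (2 * k)) r \<ge> c / (real r)\<^sup>2"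
proof -
  define a where "a = 1 / (2 * real k)"
  interpret jacobi_functional "even_power_integral k" a
    unfolding a_def by (rule jacobi_functional_even_power[OF assms])
  have a: "a \<le> 1" using assms by (simp add: a_def)
  have "a\<^sup>2 / 12 / (real r)\<^sup>2 \<le> pfm {-1..1} (\<lambda>x. x ^ (2 * k)) r" if "r \<ge> 1" for r
    unfolding pfm_def
  proof (rule cInf_greatest)
    show "pfm_values {-1..1} (\<lambda>x. x ^ (2 * k)) r \<noteq> {}"
      by (rule pfm_values_nonempty) auto
    fix v
    assume "v \<in> pfm_values {-1..1} (\<lambda>x. x ^ (2 * k)) r"
    then obtain ps where deg: "degree (\<Sum>p\<leftarrow>ps. p\<^sup>2) \<le> 2 * r"
      and v: "v = (LINT x|lebesgue_on {-1..1}. x ^ (2 * k) * poly (\<Sum>p\<leftarrow>ps. p\<^sup>2) (x ^ (2 * k)))"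
      and one: "(LINT x|lebesgue_on {-1..1}. poly (\<Sum>p\<leftarrow>ps. p\<^sup>2) (x ^ (2 * k))) = 1"
      by (auto simp: pfm_values_def sos_poly_def)
    \<comment> \<open>By linearity the bound passes from single squares to their sum, once every
      summand has degree at most \<open>r\<close>.\<close>
    have "a\<^sup>2 / 12 / (real r)\<^sup>2 * even_power_integral k (\<Sum>p\<leftarrow>ps. p\<^sup>2)
        \<le> even_power_integral k ([:0, 1:] * (\<Sum>p\<leftarrow>ps. p\<^sup>2))"
      if "\<forall>p\<in>set ps. degree p \<le> r" for ps
      using that
    proof (induction ps)
      case Nil
      then show ?case by (simp add: zero)
    next
      case (Cons p ps)
      then have "a\<^sup>2 / 12 / (real r)\<^sup>2 * even_power_integral k (p\<^sup>2)
          \<le> even_power_integral k ([:0, 1:] * p\<^sup>2)"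
        using first_moment_lower_bound[OF a \<open>r \<ge> 1\<close>, of p] by (simp only: power2_eq_square) simp
      with Cons show ?case
        by (simp add: add distrib_left del: mult_pCons_left)
    qed
    from this[of ps] degree_sos_summand_le[OF deg]
    have "a\<^sup>2 / 12 / (real r)\<^sup>2 * even_power_integral k (\<Sum>p\<leftarrow>ps. p\<^sup>2)
        \<le> even_power_integral k ([:0, 1:] * (\<Sum>p\<leftarrow>ps. p\<^sup>2))"
      by blast
    moreover have "v = even_power_integral k ([:0, 1:] * (\<Sum>p\<leftarrow>ps. p\<^sup>2))"
      unfolding v lebesgue_integral_eq_even_power_integral[symmetric] by simp
    ultimately show "a\<^sup>2 / 12 / (real r)\<^sup>2 \<le> v"
      using one by (simp only: lebesgue_integral_eq_even_power_integral mult_1_right)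
  qed
  then have "\<forall>\<^sub>F r in sequentially. a\<^sup>2 / 12 / (real r)\<^sup>2 \<le> pfm {-1..1} (\<lambda>x. x ^ (2 * k)) r"
    by (auto simp: eventually_sequentially)
  then show ?thesis
    using a_pos by (intro exI[of _ "a\<^sup>2 / 12"]) simp
qed

end
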